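(* Let $k>1$ be an integer. If $k$ is a perfect square, then the equation $x^2+(2k-1)^y=k^z$ has no solutions in positive integers $x,y,z$ with $y\in\{3,5\}$. *)

theory Defs
  imports "HOL-Computational_Algebra.Computational_Algebra"
begin

end

theory Submission
  imports Defs
begin

text \<open>
  Write \<open>k = m\<^sup>2\<close>. Then \<open>x\<^sup>2 = m^(2z) - (2m\<^sup>2 - 1)^y\<close>, which for fixed \<open>y\<close> and \<open>z > y\<close> is a
  monic polynomial of even degree in \<open>m\<close>. The idea is Runge's: with \<open>P\<close> the polynomial part of its
  square root, the value lies strictly between two consecutive squares near \<open>P\<^sup>2\<close> once \<open>m\<close> is large.
  For \<open>z > 2y\<close> one has \<open>P = m^z\<close>, so all these exponents are treated at once. Only finitely many
  pairs \<open>(m, z)\<close> remain, and they are checked by computation.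
\<close>

text \<open>The bounds on \<open>r\<close> say exactly that \<open>x ^ 2\<close> lies strictly
  between \<open>(p - 1) ^ 2\<close> and \<open>(p + 1) ^ 2\<close>; the only square there is
  \<open>p ^ 2\<close>, which \<open>r \<noteq> 0\<close> excludes.\<close>

lemma square_plus_small_not_square:
  fixes x p r :: int
  assumes eq: "x ^ 2 = p ^ 2 + r" and "r \<noteq> 0" and lo: "1 - 2 * p < r" and hi: "r < 2 * p + 1"
  shows False
proof -
  have p: "p \<ge> 1"
    using lo hi assms(2) by linarith
  have "(p - 1) ^ 2 < x ^ 2" "x ^ 2 < (p + 1) ^ 2"
    using eq lo hi by (simp_all add: power2_eq_square algebra_simps)
  then have "\<bar>p - 1\<bar> < \<bar>x\<bar>" "\<bar>x\<bar> < \<bar>p + 1\<bar>"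
    by (simp_all flip: abs_le_square_iff not_le)
  then have "\<bar>x\<bar> = p"
    using p by linarith
  then have "x ^ 2 = p ^ 2"
    by (metis power2_abs)
  with eq assms(2) show False
    by simp
qed

text \<open>
  The square root is approximated by Newton's iteration starting from \<open>m ^ z\<close>; only the final
  bracketing inequalities matter, so the iteration needs no correctness proof.
\<close>

primrec newton_sqrt :: "nat \<Rightarrow> int \<Rightarrow> int \<Rightarrow> int" where
  "newton_sqrt 0 v p = p"
| "newton_sqrt (Suc n) v p = newton_sqrt n v ((p + v div p) div 2)"

text \<open>The case \<open>v < 0\<close> occurs for small \<open>m\<close>, where
  \<open>(2 * m ^ 2 - 1) ^ y\<close> can exceed \<open>m ^ (2 * z)\<close>.\<close>

definition excludes_square :: "int \<Rightarrow> int \<Rightarrow> bool" where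
  "excludes_square v p \<longleftrightarrow> v < 0 \<or> 0 \<le> p \<and> p ^ 2 < v \<and> v < (p + 1) ^ 2"

definition no_square :: "nat \<Rightarrow> nat \<Rightarrow> int \<Rightarrow> bool" where
  "no_square y z m \<longleftrightarrow>
     (let v = m ^ (2 * z) - (2 * m ^ 2 - 1) ^ y in excludes_square v (newton_sqrt 4 v (m ^ z)))"

lemma excludes_square_imp:
  assumes "excludes_square v p"
  shows "x ^ 2 \<noteq> v"
proof
  assume v: "x ^ 2 = v"
  then have "0 \<le> v"
    using zero_le_power2[of x] by simp
  with assms have "0 \<le> p" "p ^ 2 < v" "v < (p + 1) ^ 2"
    by (auto simp: excludes_square_def)
  then show False
    using square_plus_small_not_square[of x p "v - p ^ 2"] v
    by (simp add: power2_eq_square algebra_simps)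
qed

lemma no_square_bound:
  assumes "list_all (no_square y z) [2..b]"
    and eq: "x ^ 2 + (2 * m ^ 2 - 1) ^ y = m ^ (2 * z)" and "m > 1"
  shows "b < m"
proof (rule ccontr)
  assume "\<not> b < m"
  then have "no_square y z m"
    using assms(1,3) by (simp add: list_all_iff)
  then have "x ^ 2 \<noteq> m ^ (2 * z) - (2 * m ^ 2 - 1) ^ y"
    unfolding no_square_def Let_def by (rule excludes_square_imp)
  with eq show False
    by linarith
qed

text \<open>The end 5 is dictated by \<open>z = 5\<close>, where the remainder
  \<open>12 * m ^ 4 - ...\<close> must stay below about \<open>2 * m ^ 5\<close>. It also covers
  \<open>z = 7\<close> and \<open>z = 8\<close>, where \<open>large_exponent\<close> leaves only
  \<open>m \<le> 4\<close>.\<close>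

lemma no_square_3:
  "list_all (no_square 3 4) [2..5]"
  "list_all (no_square 3 5) [2..5]"
  "list_all (no_square 3 6) [2..5]"
  "list_all (no_square 3 7) [2..5]"
  "list_all (no_square 3 8) [2..5]"
  by code_simp+

text \<open>The ends 164, 168 and 40 for \<open>z = 6, 7, 9\<close> come from comparing the leading
  term of the remainder with twice that of the approximate root: \<open>54040 * m ^ 4\<close> with
  \<open>2 * m ^ 6\<close>, \<open>336 * m ^ 6\<close> with \<open>2 * m ^ 7\<close>, and
  \<open>80 * m ^ 8\<close> with \<open>2 * m ^ 9\<close>.\<close>

lemma no_square_5_6: "list_all (no_square 5 6) [2..164]"
  by code_simp

lemma no_square_5_7: "list_all (no_square 5 7) [2..168]"
  by code_simp

lemma no_square_5_9: "list_all (no_square 5 9) [2..40]"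
  by code_simp

text \<open>The end 16 is the bound \<open>2 ^ (5 - 1)\<close> that \<open>large_exponent\<close>
  puts on \<open>m\<close> when \<open>z = 11\<close>; it is more than enough for
  \<open>z = 8\<close> and \<open>z = 10\<close>.\<close>

lemma no_square_5:
  "list_all (no_square 5 8) [2..16]"
  "list_all (no_square 5 10) [2..16]"
  "list_all (no_square 5 11) [2..16]"
  "list_all (no_square 5 12) [2..16]"
  "list_all (no_square 5 13) [2..16]"
  "list_all (no_square 5 14) [2..16]"
  by code_simp+

text \<open>With a numeral for \<open>b\<close>, these facts reduce polynomial inequalities in
  \<open>m\<close> to linear ones in which each power is an atom.\<close>

lemma power_steps:
  fixes m :: int
  assumes "0 \<le> b" "b \<le> m"
  shows "b \<le> m" "b * m \<le> m ^ 2" "b * m ^ 2 \<le> m ^ 3" "b * m ^ 3 \<le> m ^ 4" "b * m ^ 4 \<le> m ^ 5"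
    "b * m ^ 5 \<le> m ^ 6" "b * m ^ 6 \<le> m ^ 7" "b * m ^ 7 \<le> m ^ 8" "b * m ^ 8 \<le> m ^ 9"
    "b * m ^ 9 \<le> m ^ 10"
  using assms by (simp_all add: eval_nat_numeral mult_right_mono)

text \<open>Since \<open>2 * m ^ 2 - 1 > m ^ 2\<close>, the second summand alone would exceed the
  right-hand side if \<open>z \<le> y\<close>.\<close>

lemma exponent_greater:
  fixes m x :: int
  assumes "m > 1" "y > 0" and eq: "x ^ 2 + (2 * m ^ 2 - 1) ^ y = m ^ (2 * z)"
  shows "y < z"
proof (rule ccontr)
  assume "\<not> y < z"
  then have "m ^ (2 * z) \<le> (m ^ 2) ^ y"
    unfolding power_mult[symmetric] using assms(1) by (intro power_increasing) auto
  moreover have "m ^ 2 > 1"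
    using assms(1) by (rule one_less_power) simp
  then have "(m ^ 2) ^ y < (2 * m ^ 2 - 1) ^ y"
    using assms(2) by (intro power_strict_mono) auto
  ultimately show False
    using eq zero_le_power2[of x] by linarith
qed

text \<open>With root \<open>m ^ z\<close> and remainder \<open>- (N ^ y)\<close>, a solution forces
  \<open>N ^ y\<close> to be at least \<open>2 * m ^ z - 1\<close>, while \<open>N ^ y\<close> has
  size only about \<open>2 ^ y * m ^ (2 * y)\<close>.\<close>

lemma large_exponent:
  fixes m x :: int
  assumes "m > 1" "y > 0" and eq: "x ^ 2 + (2 * m ^ 2 - 1) ^ y = m ^ (2 * z)" and z: "2 * y < z"
  shows "m ^ (z - 2 * y) \<le> 2 ^ (y - 1)"
proof -
  define N where "N = 2 * m ^ 2 - 1"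
  have N: "0 < N" "N < 2 * m ^ 2"
    using one_less_power[OF assms(1), of 2] by (simp_all add: N_def)
  have "2 * m ^ z - 1 \<le> N ^ y"
  proof (rule ccontr)
    assume "\<not> 2 * m ^ z - 1 \<le> N ^ y"
    moreover have "N ^ y > 0"
      using N by simp
    moreover have "x ^ 2 = (m ^ z) ^ 2 + - (N ^ y)"
      using eq by (simp add: N_def mult.commute flip: power_mult)
    ultimately show False
      by (intro square_plus_small_not_square[of x "m ^ z" "- (N ^ y)"]) linarith+
  qed
  also have "N ^ y < (2 * m ^ 2) ^ y"
    using N assms(2) by (intro power_strict_mono) auto
  \<comment> \<open>The strict inequality between integers absorbs the \<open>- 1\<close>.\<close>
  finally have "2 * m ^ z \<le> (2 * m ^ 2) ^ y"
    by simp
  moreover have "m ^ z = m ^ (2 * y) * m ^ (z - 2 * y)"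
    using z by (simp flip: power_add)
  moreover have "(2 * m ^ 2) ^ y = 2 * (m ^ (2 * y) * 2 ^ (y - 1))"
    using assms(2) by (simp add: power_mult_distrib flip: power_mult power_Suc mult.assoc)
  ultimately have "m ^ (2 * y) * m ^ (z - 2 * y) \<le> m ^ (2 * y) * 2 ^ (y - 1)"
    by linarith
  then show ?thesis
    using assms(1) by simp
qed

lemma no_solution_3:
  fixes m x :: int
  assumes "m > 1" and eq: "x ^ 2 + (2 * m ^ 2 - 1) ^ 3 = m ^ (2 * z)"
  shows False
proof -
  have sep: "m > 5" if "z \<in> {4, 5, 6, 7, 8}"
    using that eq no_square_3[THEN no_square_bound[OF _ _ assms(1)]] by auto
  have "z > 3"
    by (rule exponent_greater[OF assms(1) _ eq]) simp
  then consider "z = 4" | "z = 5" | "z = 6" | "z > 6"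
    by linarith
  then show False
  proof cases
    case 1
    show False
    proof (rule square_plus_small_not_square)
      show "x ^ 2 = (m ^ 4 - 4 * m ^ 2 - 2) ^ 2 + (- 22 * m ^ 2 - 3)"
        using eq unfolding 1 by (simp add: eval_nat_numeral algebra_simps)
    qed (use sep 1 power_steps[of 6 m] in auto)
  next
    case 2
    show False
    proof (rule square_plus_small_not_square)
      show "x ^ 2 = (m ^ 5 - 4 * m) ^ 2 + (12 * m ^ 4 - 22 * m ^ 2 + 1)"
        using eq unfolding 2 by (simp add: eval_nat_numeral algebra_simps)
    qed (use sep 2 power_steps[of 6 m] in auto)
  next
    case 3
    show False
    proof (rule square_plus_small_not_square)
      show "x ^ 2 = (m ^ 6 - 4) ^ 2 + (12 * m ^ 4 - 6 * m ^ 2 - 15)"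
        using eq unfolding 3 by (simp add: eval_nat_numeral algebra_simps)
    qed (use sep 3 power_steps[of 6 m] in auto)
  next
    case 4
    have less: "m ^ (z - 6) \<le> 4"
      using large_exponent[OF assms(1) _ eq] 4 by simp
    have "m \<le> m ^ (z - 6)"
      using 4 assms(1) by (intro self_le_power) auto
    \<comment> \<open>Taking the least possible base 2 bounds \<open>z\<close>; the preceding fact
      bounds \<open>m\<close> by 4, against \<open>sep\<close>.\<close>
    moreover have "(2::int) ^ (z - 6) \<le> m ^ (z - 6)"
      using assms(1) by (intro power_mono) auto
    then have "(2::int) ^ (z - 6) \<le> 2 ^ 2"
      using less by simp
    then have "z - 6 \<le> 2"
      by (rule power_le_imp_le_exp[rotated]) simp
    then have "z \<in> {7, 8}"
      using 4 by auto
    ultimately show False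
      using sep less by auto
  qed
qed

lemma no_solution_5:
  fixes m x :: int
  assumes "m > 1" and eq: "x ^ 2 + (2 * m ^ 2 - 1) ^ 5 = m ^ (2 * z)"
  shows False
proof -
  have sep: "m > 16" if "z \<in> {8, 10, 11, 12, 13, 14}"
    using that eq no_square_5[THEN no_square_bound[OF _ _ assms(1)]] by auto
  have "z > 5"
    by (rule exponent_greater[OF assms(1) _ eq]) simp
  then consider "z = 6" | "z = 7" | "z = 8" | "z = 9" | "z = 10" | "z > 10"
    by linarith
  then show False
  proof cases
    case 1
    have m: "m \<ge> 165"
      using no_square_bound[OF no_square_5_6 eq[unfolded 1] assms(1)] by simp
    show False
    proof (rule square_plus_small_not_square)
      \<comment> \<open>The coefficients are those of the polynomial part of the square root of
        \<open>m ^ 12 - (2 * m ^ 2 - 1) ^ 5\<close>, so the remainder has degree below 6.\<close>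
      show "x ^ 2 = (m ^ 6 - 16 * m ^ 4 - 88 * m ^ 2 - 1448) ^ 2
          + (- 54040 * m ^ 4 - 254858 * m ^ 2 - 2096703)"
        using eq unfolding 1 by (simp add: eval_nat_numeral algebra_simps)
    qed (use m power_steps[of 165 m] in auto)
  next
    case 2
    have m: "m \<ge> 169"
      using no_square_bound[OF no_square_5_7 eq[unfolded 2] assms(1)] by simp
    show False
    proof (rule square_plus_small_not_square)
      show "x ^ 2 = (m ^ 7 - 16 * m ^ 3 + 40 * m) ^ 2
          + (- 336 * m ^ 6 + 1320 * m ^ 4 - 1610 * m ^ 2 + 1)"
        using eq unfolding 2 by (simp add: eval_nat_numeral algebra_simps)
    qed (use m power_steps[of 169 m] in auto)
  next
    case 3
    have m: "m \<ge> 17"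
      using sep 3 by simp
    show False
    proof (rule square_plus_small_not_square)
      show "x ^ 2 = (m ^ 8 - 16 * m ^ 2 + 40) ^ 2
          + (- 80 * m ^ 6 - 216 * m ^ 4 + 1270 * m ^ 2 - 1599)"
        using eq unfolding 3 by (simp add: eval_nat_numeral algebra_simps)
    qed (use m power_steps[of 17 m] in auto)
  next
    case 4
    have m: "m \<ge> 41"
      using no_square_bound[OF no_square_5_9 eq[unfolded 4] assms(1)] by simp
    show False
    proof (rule square_plus_small_not_square)
      show "x ^ 2 = (m ^ 9 - 16 * m) ^ 2
          + (80 * m ^ 8 - 80 * m ^ 6 + 40 * m ^ 4 - 266 * m ^ 2 + 1)"
        using eq unfolding 4 by (simp add: eval_nat_numeral algebra_simps)
    qed (use m power_steps[of 41 m] in auto)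
  next
    case 5
    have m: "m \<ge> 17"
      using sep 5 by simp
    show False
    proof (rule square_plus_small_not_square)
      show "x ^ 2 = (m ^ 10 - 16) ^ 2
          + (80 * m ^ 8 - 80 * m ^ 6 + 40 * m ^ 4 - 10 * m ^ 2 - 255)"
        using eq unfolding 5 by (simp add: eval_nat_numeral algebra_simps)
    qed (use m power_steps[of 17 m] in auto)
  next
    case 6
    have less: "m ^ (z - 10) \<le> 16"
      using large_exponent[OF assms(1) _ eq] 6 by simp
    have "m \<le> m ^ (z - 10)"
      using 6 assms(1) by (intro self_le_power) auto
    moreover have "(2::int) ^ (z - 10) \<le> m ^ (z - 10)"
      using assms(1) by (intro power_mono) auto
    then have "(2::int) ^ (z - 10) \<le> 2 ^ 4"
      using less by simp
    then have "z - 10 \<le> 4"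
      by (rule power_le_imp_le_exp[rotated]) simp
    then have "z \<in> {11, 12, 13, 14}"
      using 6 by auto
    ultimately show False
      using sep less by auto
  qed
qed

theorem theorem1p2:
  fixes k :: int
  assumes "k > 1"
    and "is_square k"
  shows "\<not> (\<exists>x y z :: nat. x > 0 \<and> y > 0 \<and> z > 0 \<and> y \<in> {3, 5} \<and>
           (int x) ^ 2 + (2 * k - 1) ^ y = k ^ z)"
proof -
  obtain n where "k = n ^ 2"
    using assms(2) by (auto elim: is_nth_powerE)
  \<comment> \<open>The root \<open>n\<close> may be negative, so \<open>m\<close> is its absolute
    value.\<close>
  then obtain m where k: "k = m ^ 2" and "m \<ge> 0"
    by (metis abs_ge_zero power2_abs)
  with assms(1) have "m > 1"
    by (metis linorder_not_le power_le_one)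
  then show ?thesis
    unfolding k power_mult[symmetric] using no_solution_3 no_solution_5 by blast
qed

end
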